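(* Let $\mathcal{H}$ be a complex Hilbert space and let $T_1,T_2\in\mathbb{B}(\mathcal{H})$. Then $$\frac{1}{2}\,\left\|(T_1,T_2)\right\|_{e}\le \omega\left(\begin{bmatrix} O & T_1\\ T_2^{*} & O\end{bmatrix}\right).$$
   Context: $\mathbb{B}(\mathcal{H})$ is the $C^*$-algebra of all bounded linear operators on $\mathcal{H}$, $\|\cdot\|$ is the operator norm, and $O$ is the zero operator. The numerical radius of an operator $T$ on a Hilbert space is $\omega(T)=\sup_{\|x\|=1}|\langle Tx,x\rangle|$. A $2\times2$ operator matrix with entries in $\mathbb{B}(\mathcal{H})$ is regarded as an operator on the Hilbert space $\mathcal{H}\oplus\mathcal{H}$. For $T_1,T_2\in\mathbb{B}(\mathcal{H})$, the Euclidean operator norm of the pair is $\|(T_1,T_2)\|_e=\sup\{\|\lambda_1T_1+\lambda_2T_2\| : \lambda_1,\lambda_2\in\mathbb{C},\ |\lambda_1|^2+|\lambda_2|^2=1\}$. *)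

theory Defs
  imports "HOL-Analysis.Analysis"
begin

section \<open>Complex Hilbert spaces\<close>

text \<open>
  A complex inner product space is built on top of the real inner product space underlying it,
  so that \<open>inner x y = Re (cinner x y)\<close> and the norm is the library's
  \<open>norm x = sqrt (inner x x) = sqrt (Re (cinner x x))\<close>; positive definiteness of \<open>cinner\<close> is
  inherited from \<open>inner\<close>.  The form \<open>cinner\<close> is linear in its first argument.
\<close>

class complex_inner = real_inner +
  fixes scaleC :: "complex \<Rightarrow> 'a \<Rightarrow> 'a"  (infixr \<open>*\<^sub>C\<close> 75)
    and cinner :: "'a \<Rightarrow> 'a \<Rightarrow> complex"
  assumes scaleC_add_right: "c *\<^sub>C (x + y) = c *\<^sub>C x + c *\<^sub>C y"
    and scaleC_add_left: "(c + d) *\<^sub>C x = c *\<^sub>C x + d *\<^sub>C x"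
    and scaleC_scaleC: "c *\<^sub>C d *\<^sub>C x = (c * d) *\<^sub>C x"
    and scaleC_of_real: "complex_of_real r *\<^sub>C x = r *\<^sub>R x"
    and cinner_commute: "cinner x y = cnj (cinner y x)"
    and cinner_add_left: "cinner (x + y) z = cinner x z + cinner y z"
    and cinner_scaleC_left: "cinner (c *\<^sub>C x) y = c * cinner x y"
    and inner_eq_Re_cinner: "inner x y = Re (cinner x y)"

class complex_hilbert = complex_inner + complete_space

lemma cinner_self: "cinner x x = complex_of_real ((norm x)\<^sup>2)"
  for x :: "'a::complex_inner"
proof (rule complex_eqI)
  show "Re (cinner x x) = Re (complex_of_real ((norm x)\<^sup>2))"
    by (simp add: power2_norm_eq_inner inner_eq_Re_cinner)
  have "Im (cinner x x) = - Im (cinner x x)"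
    by (subst cinner_commute) simp
  then show "Im (cinner x x) = Im (complex_of_real ((norm x)\<^sup>2))" by simp
qed

instantiation complex :: complex_hilbert
begin
definition scaleC_complex :: "complex \<Rightarrow> complex \<Rightarrow> complex" where "scaleC_complex c x = c * x"
definition cinner_complex :: "complex \<Rightarrow> complex \<Rightarrow> complex" where "cinner_complex x y = x * cnj y"
instance
  by standard
    (simp_all add: scaleC_complex_def cinner_complex_def inner_complex_def
      scaleR_conv_of_real algebra_simps)
end

text \<open>The Hilbert space direct sum, with the library's norm
  \<open>norm (x, y) = sqrt ((norm x)\<^sup>2 + (norm y)\<^sup>2)\<close> on pairs.\<close>

instantiation prod :: (complex_inner, complex_inner) complex_inner
begin
definition scaleC_prod :: "complex \<Rightarrow> 'a \<times> 'b \<Rightarrow> 'a \<times> 'b"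
  where "scaleC_prod c p = (c *\<^sub>C fst p, c *\<^sub>C snd p)"
definition cinner_prod :: "'a \<times> 'b \<Rightarrow> 'a \<times> 'b \<Rightarrow> complex"
  where "cinner_prod p q = cinner (fst p) (fst q) + cinner (snd p) (snd q)"
instance
proof
  fix p q r :: "'a \<times> 'b" and c d :: complex and a :: real
  show "c *\<^sub>C (p + q) = c *\<^sub>C p + c *\<^sub>C q"
    by (simp add: scaleC_prod_def scaleC_add_right)
  show "(c + d) *\<^sub>C p = c *\<^sub>C p + d *\<^sub>C p"
    by (simp add: scaleC_prod_def scaleC_add_left)
  show "c *\<^sub>C d *\<^sub>C p = (c * d) *\<^sub>C p"
    by (simp add: scaleC_prod_def scaleC_scaleC)
  show "complex_of_real a *\<^sub>C p = a *\<^sub>R p"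
    by (simp add: scaleC_prod_def scaleC_of_real scaleR_prod_def)
  show "cinner p q = cnj (cinner q p)"
    unfolding cinner_prod_def
    using cinner_commute[of "fst p" "fst q"] cinner_commute[of "snd p" "snd q"] by simp
  show "cinner (p + q) r = cinner p r + cinner q r"
    by (simp add: cinner_prod_def cinner_add_left)
  show "cinner (c *\<^sub>C p) q = c * cinner p q"
    by (simp add: cinner_prod_def scaleC_prod_def cinner_scaleC_left distrib_left)
  show "inner p q = Re (cinner p q)"
    by (simp add: cinner_prod_def inner_prod_def inner_eq_Re_cinner)
qed
end

instance prod :: (complex_hilbert, complex_hilbert) complex_hilbert ..

section \<open>Bounded operators\<close>

text \<open>The operator norm of a bounded complex linear operator is the library's \<open>onorm\<close>.\<close>

definition bounded_clinear :: "('a::complex_inner \<Rightarrow> 'b::complex_inner) \<Rightarrow> bool"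
  where "bounded_clinear T \<longleftrightarrow> bounded_linear T \<and> (\<forall>c x. T (c *\<^sub>C x) = c *\<^sub>C T x)"

definition cadjoint :: "('a::complex_inner \<Rightarrow> 'b::complex_inner) \<Rightarrow> 'b \<Rightarrow> 'a"
  where "cadjoint T = (THE S. \<forall>x y. cinner (T x) y = cinner x (S y))"

text \<open>The supremum is taken in \<open>[0, \<infinity>)\<close>; inserting \<open>0\<close> only matters for the zero space, where there
  is no unit vector and \<open>Sup {}\<close> is unspecified on the reals.\<close>

definition numerical_radius :: "('a::complex_inner \<Rightarrow> 'a) \<Rightarrow> real"
  where "numerical_radius T = Sup (insert 0 {cmod (cinner (T x) x) | x. norm x = 1})"

definition euclidean_onorm ::
    "('a::complex_inner \<Rightarrow> 'b::complex_inner) \<Rightarrow> ('a \<Rightarrow> 'b) \<Rightarrow> real"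
  where "euclidean_onorm T\<^sub>1 T\<^sub>2 =
    Sup {onorm (\<lambda>x. l\<^sub>1 *\<^sub>C T\<^sub>1 x + l\<^sub>2 *\<^sub>C T\<^sub>2 x) | l\<^sub>1 l\<^sub>2. (cmod l\<^sub>1)\<^sup>2 + (cmod l\<^sub>2)\<^sup>2 = 1}"

text \<open>\<open>op_matrix A B C D\<close> has first row \<open>A, B\<close> and second row \<open>C, D\<close>.\<close>

definition op_matrix ::
    "('a::complex_inner \<Rightarrow> 'a) \<Rightarrow> ('a \<Rightarrow> 'a) \<Rightarrow> ('a \<Rightarrow> 'a) \<Rightarrow> ('a \<Rightarrow> 'a) \<Rightarrow> 'a \<times> 'a \<Rightarrow> 'a \<times> 'a"
  where "op_matrix A B C D = (\<lambda>(x, y). (A x + B y, C x + D y))"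

section \<open>Existence of the adjoint\<close>

text \<open>The description in the definition of \<open>cadjoint\<close> is proper on Hilbert spaces; this needs the
  Riesz representation theorem, proved here by minimising \<open>(norm x)\<^sup>2 / 2 - f x\<close>.\<close>

lemma riesz_representation_real:
  fixes f :: "'a::{real_inner, complete_space} \<Rightarrow> real"
  assumes "bounded_linear f"
  shows "\<exists>z. \<forall>x. f x = inner x z"
proof -
  interpret f: bounded_linear f by fact
  define g where "g x = (norm x)\<^sup>2 / 2 - f x" for x
  obtain K where K: "\<And>x. norm (f x) \<le> norm x * K" using f.bounded by blast
  have lower: "- (K\<^sup>2 / 2) \<le> g x" for x
  proof -
    have "f x \<le> norm x * K" using K[of x] by (simp add: abs_le_iff)
    moreover have "0 \<le> (norm x - K)\<^sup>2" by simp
    ultimately show ?thesis unfolding g_def by (simp add: power2_eq_square algebra_simps)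
  qed
  define m where "m = Inf (range g)"
  have bdd: "bdd_below (range g)" using lower by (auto simp: bdd_below_def)
  have m_le: "m \<le> g x" for x unfolding m_def using bdd by (auto intro: cInf_lower)
  have "\<exists>x. g x < m + inverse (real (Suc n))" for n
  proof -
    have "Inf (range g) < m + inverse (real (Suc n))" unfolding m_def by simp
    then show ?thesis using cInf_less_iff[OF _ bdd] by auto
  qed
  then obtain X where X: "\<And>n. g (X n) < m + inverse (real (Suc n))" by metis
  have par: "(norm (x - y))\<^sup>2 \<le> 4 * (g x + g y - 2 * m)" for x y
  proof -
    define w where "w = (1/2) *\<^sub>R (x + y)"
    have "f w = (f x + f y) / 2" by (simp add: w_def f.add f.scaleR)
    moreover have "(norm w)\<^sup>2 = (2 * (norm x)\<^sup>2 + 2 * (norm y)\<^sup>2 - (norm (x - y))\<^sup>2) / 4"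
      unfolding w_def power2_norm_eq_inner
      by (simp add: inner_add_left inner_add_right inner_diff_left inner_diff_right
          inner_commute field_simps)
    ultimately have "(norm (x - y))\<^sup>2 = 4 * (g x + g y - 2 * g w)"
      unfolding g_def by (simp add: field_simps)
    with m_le[of w] show ?thesis by simp
  qed
  have "Cauchy X"
  proof (rule metric_CauchyI)
    fix e :: real assume e: "0 < e"
    then obtain N where N: "inverse (real (Suc N)) < e\<^sup>2 / 8"
      using reals_Archimedean[of "e\<^sup>2 / 8"] by auto
    have "dist (X p) (X q) < e" if "N \<le> p" "N \<le> q" for p q
    proof -
      have mono: "inverse (real (Suc k)) \<le> inverse (real (Suc N))" if "N \<le> k" for k
        using that by (intro le_imp_inverse_le) auto
      have "(norm (X p - X q))\<^sup>2 \<le> 4 * (g (X p) + g (X q) - 2 * m)" by (rule par)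
      also have "g (X p) + g (X q) - 2 * m < 2 * inverse (real (Suc N))"
        using less_le_trans[OF X[of p] add_left_mono[OF mono[OF that(1)]]]
          less_le_trans[OF X[of q] add_left_mono[OF mono[OF that(2)]]] by simp
      also have "4 * (2 * inverse (real (Suc N))) < e\<^sup>2" using N by simp
      finally show ?thesis using e by (simp add: dist_norm power2_less_imp_less)
    qed
    then show "\<exists>M. \<forall>p\<ge>M. \<forall>q\<ge>M. dist (X p) (X q) < e" by blast
  qed
  then have "convergent X" by (rule Cauchy_convergent)
  then obtain z where z: "X \<longlonglongrightarrow> z" unfolding convergent_def by (rule exE)
  have "(\<lambda>n. g (X n)) \<longlonglongrightarrow> g z"
    unfolding g_def by (intro tendsto_intros z f.tendsto) simp
  moreover have "(\<lambda>n. m + inverse (real (Suc n))) \<longlonglongrightarrow> m + 0"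
    by (intro tendsto_intros LIMSEQ_inverse_real_of_nat)
  ultimately have "g z \<le> m + 0"
    by (rule LIMSEQ_le) (intro exI[of _ 0] allI impI less_imp_le X)
  then have gz: "g z \<le> m" by simp
  have "f x = inner x z" for x
  proof (cases "x = 0")
    case False
    define d where "d = f x - inner x z"
    define N where "N = inner x x"
    have N: "0 < N" using False by (simp add: N_def)
    define t where "t = d / N"
    have tN: "t * N = d" using N by (simp add: t_def)
    have "(norm (z + t *\<^sub>R x))\<^sup>2 = (norm z)\<^sup>2 + 2 * t * inner x z + t * (t * N)"
      unfolding power2_norm_eq_inner N_def
      by (simp add: inner_add_left inner_add_right inner_commute[of z x] distrib_left)
    moreover have "f (z + t *\<^sub>R x) = f z + t * f x" by (simp add: f.add f.scaleR)
    moreover have "g z \<le> g (z + t *\<^sub>R x)" by (rule order_trans[OF gz m_le])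
    ultimately have "0 \<le> t * inner x z + t * d / 2 - t * f x"
      unfolding g_def tN by (simp add: add_divide_distrib)
    also have "\<dots> = - (t * d / 2)" by (simp add: d_def algebra_simps)
    finally have "d * d / N \<le> 0" by (simp add: t_def)
    then have "d = 0" using N by (auto simp: divide_le_0_iff mult_le_0_iff)
    then show ?thesis by (simp add: d_def)
  qed (simp add: f.zero)
  then show ?thesis by blast
qed

lemma cinner_ext:
  fixes y z :: "'a::complex_inner"
  assumes "\<And>x. cinner x y = cinner x z"
  shows "y = z"
proof -
  have "inner x y = inner x z" for x by (simp add: inner_eq_Re_cinner assms)
  then have "inner (y - z) (y - z) = 0" by (simp add: inner_diff_right)
  then show ?thesis by simp
qed

lemma cadjoint_works:
  fixes T :: "'a::complex_hilbert \<Rightarrow> 'b::complex_inner"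
  assumes T: "bounded_clinear T"
  shows "cinner (T x) y = cinner x (cadjoint T y)"
proof -
  have bl: "bounded_linear T" and sc: "\<And>c x. T (c *\<^sub>C x) = c *\<^sub>C T x"
    using T by (auto simp: bounded_clinear_def)
  have "\<exists>z. \<forall>x. inner (T x) y = inner x z" for y
    by (rule riesz_representation_real)
      (rule bounded_linear_compose[OF bounded_linear_inner_left bl])
  then obtain S where S: "\<And>x y. inner (T x) y = inner x (S y)" by metis
  have S': "cinner (T x) y = cinner x (S y)" for x y
  proof (rule complex_eqI)
    show "Re (cinner (T x) y) = Re (cinner x (S y))"
      using S[of x y] by (simp add: inner_eq_Re_cinner)
    show "Im (cinner (T x) y) = Im (cinner x (S y))"
      using S[of "(- \<i>) *\<^sub>C x" y] by (simp add: inner_eq_Re_cinner sc cinner_scaleC_left)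
  qed
  have "cadjoint T = S"
    unfolding cadjoint_def
  proof (rule the_equality)
    show "\<forall>x y. cinner (T x) y = cinner x (S y)" using S' by blast
  next
    fix R assume R: "\<forall>x y. cinner (T x) y = cinner x (R y)"
    have "cinner x (R y) = cinner x (S y)" for x y using R S'[of x y] by simp
    then show "R = S" by (rule ext[OF cinner_ext])
  qed
  then show ?thesis by (simp add: S')
qed

end

theory Submission
  imports Defs
begin

text \<open>
  Write \<open>A\<close> for the operator matrix, \<open>w\<close> for its numerical radius, and put
  \<open>a = \<langle>T\<^sub>1 y, x\<rangle>\<close>, \<open>b = \<langle>T\<^sub>2 y, x\<rangle>\<close>.  The quadratic form of \<open>A\<close> at \<open>(x, y)\<close> is \<open>a + cnj b\<close>.
  Rotating only \<open>x\<close> by a unimodular \<open>u\<close> changes this to \<open>cnj u * a + u * cnj b\<close>, so the two phases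
  move in opposite directions and some \<open>u\<close> aligns them (\<open>exists_aligning_phase\<close>); the modulus is then
  \<open>cmod a + cmod b\<close>.  After balancing the two components, so that they have equal norm, the
  definition of \<open>w\<close> gives
    \<open>cmod a + cmod b \<le> 2 * w * norm x * norm y\<close>  (\<open>offdiagonal_forms_le\<close>).
  For \<open>(l\<^sub>1, l\<^sub>2)\<close> in the unit sphere of \<open>\<complex>\<^sup>2\<close> both coefficients have modulus at most \<open>1\<close>, hence the
  sesquilinear form \<open>l\<^sub>1 * a + l\<^sub>2 * b\<close> of \<open>l\<^sub>1 T\<^sub>1 + l\<^sub>2 T\<^sub>2\<close> is bounded by \<open>2 * w\<close>, and with it the
  operator norm.
\<close>

section \<open>Complex inner products\<close>

lemma cinner_scaleC_right:
  fixes x y :: "'a::complex_inner"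
  shows "cinner x (c *\<^sub>C y) = cnj c * cinner x y"
  by (metis cinner_commute cinner_scaleC_left complex_cnj_mult)

lemma norm_scaleC:
  fixes x :: "'a::complex_inner"
  shows "norm (c *\<^sub>C x) = cmod c * norm x"
proof -
  have "complex_of_real ((norm (c *\<^sub>C x))\<^sup>2) = c * cnj c * complex_of_real ((norm x)\<^sup>2)"
    by (simp only: cinner_self[symmetric] cinner_scaleC_left cinner_scaleC_right mult.assoc
        mult.left_commute)
  also have "\<dots> = complex_of_real ((cmod c * norm x)\<^sup>2)"
    by (simp add: complex_norm_square[symmetric] power_mult_distrib)
  finally have "(norm (c *\<^sub>C x))\<^sup>2 = (cmod c * norm x)\<^sup>2"
    by (simp only: of_real_eq_iff)
  then show ?thesis
    by (simp add: power2_eq_iff_nonneg)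
qed

text \<open>The real Cauchy-Schwarz inequality applies after a rotation of \<open>x\<close> has made \<open>cinner x y\<close> real
  and nonnegative.\<close>

lemma cmod_cinner_le:
  fixes x y :: "'a::complex_inner"
  shows "cmod (cinner x y) \<le> norm x * norm y"
proof -
  define u where "u = cis (- Arg (cinner x y))"
  have "u * cinner x y = u * rcis (cmod (cinner x y)) (Arg (cinner x y))"
    by (simp add: rcis_cmod_Arg)
  also have "\<dots> = complex_of_real (cmod (cinner x y))"
    by (simp add: u_def rcis_def cis_mult mult.left_commute)
  finally have "cmod (cinner x y) = inner (u *\<^sub>C x) y"
    by (simp add: inner_eq_Re_cinner cinner_scaleC_left)
  also have "\<dots> \<le> norm (u *\<^sub>C x) * norm y"
    by (rule norm_cauchy_schwarz)
  finally show ?thesis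
    by (simp add: norm_scaleC u_def)
qed

lemma exists_aligning_phase:
  "\<exists>u. cmod u = 1 \<and> cmod (cnj u * a + u * cnj b) = cmod a + cmod b"
proof -
  \<comment> \<open>The phases of the two summands are \<open>Arg a - t\<close> and \<open>t - Arg b\<close>, which agree at the midpoint.\<close>
  define t where "t = (Arg a + Arg b) / 2"
  have "cnj (cis t) * a = cnj (cis t) * rcis (cmod a) (Arg a)"
    by (simp add: rcis_cmod_Arg)
  also have "\<dots> = complex_of_real (cmod a) * cis ((Arg a - Arg b) / 2)"
    by (simp add: rcis_def cis_cnj cis_mult mult.left_commute t_def field_simps)
  finally have a: "cnj (cis t) * a = complex_of_real (cmod a) * cis ((Arg a - Arg b) / 2)" .
  have "cis t * cnj b = cis t * cnj (rcis (cmod b) (Arg b))"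
    by (simp add: rcis_cmod_Arg)
  also have "\<dots> = complex_of_real (cmod b) * cis ((Arg a - Arg b) / 2)"
    by (simp add: rcis_def cis_cnj cis_mult mult.left_commute t_def field_simps)
  finally have b: "cis t * cnj b = complex_of_real (cmod b) * cis ((Arg a - Arg b) / 2)" .
  have "cmod (cnj (cis t) * a + cis t * cnj b)
      = cmod (complex_of_real (cmod a + cmod b) * cis ((Arg a - Arg b) / 2))"
    by (simp only: a b of_real_add distrib_right)
  also have "\<dots> = cmod a + cmod b"
    by (simp only: norm_mult norm_of_real norm_cis) simp
  finally show ?thesis
    by (intro exI[of _ "cis t"]) simp
qed

section \<open>The numerical radius of an off-diagonal operator matrix\<close>

text \<open>The existence of some bound \<open>K\<close> makes the supremum that defines the numerical radius
  meaningful; the numerical radius is then itself such a bound.\<close>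

lemma cmod_cinner_le_numerical_radius:
  fixes A :: "'a::complex_inner \<Rightarrow> 'a"
  assumes scale: "\<And>r z. A (r *\<^sub>R z) = r *\<^sub>R A z"
    and bound: "\<And>z. cmod (cinner (A z) z) \<le> K * (norm z)\<^sup>2"
  shows "cmod (cinner (A z) z) \<le> numerical_radius A * (norm z)\<^sup>2"
    and "0 \<le> numerical_radius A"
proof -
  let ?S = "insert 0 {cmod (cinner (A x) x) | x. norm x = 1}"
  have bdd: "bdd_above ?S"
  proof (rule bdd_aboveI[of _ "max 0 K"])
    fix s assume "s \<in> ?S"
    then consider "s = 0" | x where "s = cmod (cinner (A x) x)" "norm x = 1"
      by blast
    then show "s \<le> max 0 K"
    proof cases
      case (2 x)
      then show ?thesis
        using bound[of x] by simp
    qed simp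
  qed
  show "0 \<le> numerical_radius A"
    unfolding numerical_radius_def by (rule cSup_upper[OF _ bdd]) simp
  show "cmod (cinner (A z) z) \<le> numerical_radius A * (norm z)\<^sup>2"
  proof (cases "z = 0")
    case True
    then show ?thesis
      using bound[of z] by simp
  next
    case False
    define x where "x = sgn z"
    have x: "norm x = 1"
      using False by (simp add: x_def norm_sgn)
    have z: "z = norm z *\<^sub>R x"
      using False by (simp add: x_def sgn_div_norm)
    have "cinner (A z) z = cinner (norm z *\<^sub>R A x) (norm z *\<^sub>R x)"
      by (subst (1 2) z) (simp only: scale)
    also have "\<dots> = complex_of_real ((norm z)\<^sup>2) * cinner (A x) x"
      by (simp add: scaleC_of_real[symmetric] cinner_scaleC_left cinner_scaleC_right
          power2_eq_square)
    finally have "cmod (cinner (A z) z) = cmod (cinner (A x) x) * (norm z)\<^sup>2"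
      by (simp add: norm_mult norm_power)
    moreover have "cmod (cinner (A x) x) \<le> numerical_radius A"
      unfolding numerical_radius_def using x by (intro cSup_upper[OF _ bdd]) blast
    ultimately show ?thesis
      by (simp add: mult_right_mono)
  qed
qed

lemma cadjoint_scaleC:
  fixes T :: "'a::complex_hilbert \<Rightarrow> 'b::complex_inner"
  assumes "bounded_clinear T"
  shows "cadjoint T (c *\<^sub>C y) = c *\<^sub>C cadjoint T y"
  by (rule cinner_ext) (simp add: cadjoint_works[OF assms, symmetric] cinner_scaleC_right)

lemma cinner_op_matrix_offdiagonal:
  fixes T\<^sub>1 T\<^sub>2 :: "'a::complex_hilbert \<Rightarrow> 'a"
  assumes "bounded_clinear T\<^sub>2"
  shows "cinner (op_matrix (\<lambda>_. 0) T\<^sub>1 (cadjoint T\<^sub>2) (\<lambda>_. 0) (x, y)) (x, y)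
    = cinner (T\<^sub>1 y) x + cnj (cinner (T\<^sub>2 y) x)"
proof -
  have "cinner (cadjoint T\<^sub>2 x) y = cnj (cinner (T\<^sub>2 y) x)"
    by (simp add: cadjoint_works[OF assms] cinner_commute[of "cadjoint T\<^sub>2 x" y])
  then show ?thesis
    by (simp add: op_matrix_def cinner_prod_def)
qed

lemma bounded_clinear_cinner_bound:
  fixes T :: "'a::complex_inner \<Rightarrow> 'b::complex_inner"
  assumes "bounded_clinear T"
  shows "cmod (cinner (T y) x) \<le> onorm T * norm y * norm x"
proof -
  have "norm (T y) \<le> onorm T * norm y"
    using assms by (intro onorm) (simp add: bounded_clinear_def)
  then show ?thesis
    using cmod_cinner_le[of "T y" x] mult_right_mono[of "norm (T y)" _ "norm x"]
    by fastforce
qed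

text \<open>The vector \<open>(norm y * u * x, norm x * y)\<close> is the test vector: both components have norm
  \<open>norm x * norm y\<close>, so that the sum \<open>(norm x)\<^sup>2 + (norm y)\<^sup>2\<close>, which \<open>(x, y)\<close> itself would produce,
  is replaced by the product, and \<open>u\<close> is the aligning phase.\<close>

lemma offdiagonal_forms_le:
  fixes T\<^sub>1 T\<^sub>2 :: "'a::complex_hilbert \<Rightarrow> 'a"
  assumes T1: "bounded_clinear T\<^sub>1" and T2: "bounded_clinear T\<^sub>2"
  defines "w \<equiv> numerical_radius (op_matrix (\<lambda>_. 0) T\<^sub>1 (cadjoint T\<^sub>2) (\<lambda>_. 0))"
  shows "cmod (cinner (T\<^sub>1 y) x) + cmod (cinner (T\<^sub>2 y) x) \<le> 2 * w * norm x * norm y"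
    and "0 \<le> w"
proof -
  define A where "A = op_matrix (\<lambda>_. 0) T\<^sub>1 (cadjoint T\<^sub>2) (\<lambda>_. 0)"
  have sc1: "T\<^sub>1 (c *\<^sub>C v) = c *\<^sub>C T\<^sub>1 v" and sc2: "T\<^sub>2 (c *\<^sub>C v) = c *\<^sub>C T\<^sub>2 v" for c v
    using T1 T2 by (auto simp: bounded_clinear_def)
  have form: "cinner (A (v, v')) (v, v') = cinner (T\<^sub>1 v') v + cnj (cinner (T\<^sub>2 v') v)" for v v'
    unfolding A_def by (rule cinner_op_matrix_offdiagonal[OF T2])
  have scale: "A (r *\<^sub>R z) = r *\<^sub>R A z" for r z
    by (cases z)
      (simp add: A_def op_matrix_def scaleC_of_real[symmetric] scaleC_prod_def sc1 cadjoint_scaleC[OF T2])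
  have bound: "cmod (cinner (A z) z) \<le> (onorm T\<^sub>1 + onorm T\<^sub>2) * (norm z)\<^sup>2" for z
  proof (cases z)
    case (Pair v v')
    have nonneg: "0 \<le> onorm T\<^sub>1 + onorm T\<^sub>2"
      using T1 T2 by (simp add: bounded_clinear_def onorm_pos_le)
    have "norm v' * norm v \<le> norm z * norm z"
      using norm_fst_le[of v v'] norm_snd_le[of v' v] by (intro mult_mono) (simp_all add: Pair)
    then have le: "(onorm T\<^sub>1 + onorm T\<^sub>2) * (norm v' * norm v)
        \<le> (onorm T\<^sub>1 + onorm T\<^sub>2) * (norm z)\<^sup>2"
      using nonneg by (simp add: power2_eq_square mult_left_mono)
    have "cmod (cinner (A z) z) \<le> cmod (cinner (T\<^sub>1 v') v) + cmod (cinner (T\<^sub>2 v') v)"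
      using norm_triangle_ineq[of "cinner (T\<^sub>1 v') v" "cnj (cinner (T\<^sub>2 v') v)"]
      by (simp add: Pair form)
    also have "\<dots> \<le> (onorm T\<^sub>1 + onorm T\<^sub>2) * (norm v' * norm v)"
      using bounded_clinear_cinner_bound[OF T1, of v' v] bounded_clinear_cinner_bound[OF T2, of v' v]
      by (simp add: distrib_right mult.assoc)
    finally show ?thesis
      using le by linarith
  qed
  note radius = cmod_cinner_le_numerical_radius[OF scale bound, folded A_def]
  show "0 \<le> w"
    unfolding w_def A_def[symmetric] by (rule radius(2))
  define a where "a = cinner (T\<^sub>1 y) x"
  define b where "b = cinner (T\<^sub>2 y) x"
  show "cmod (cinner (T\<^sub>1 y) x) + cmod (cinner (T\<^sub>2 y) x) \<le> 2 * w * norm x * norm y"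
  proof (cases "norm x * norm y = 0")
    case True
    have "a = 0" "b = 0"
      using True bounded_clinear_cinner_bound[OF T1, of y x]
        bounded_clinear_cinner_bound[OF T2, of y x] by (auto simp: a_def b_def)
    then show ?thesis
      using True by (auto simp: a_def b_def)
  next
    case False
    define N where "N = norm x * norm y"
    have N: "0 < N"
      using False by (simp add: N_def)
    obtain u where u: "cmod u = 1" and align: "cmod (cnj u * a + u * cnj b) = cmod a + cmod b"
      using exists_aligning_phase by blast
    define z where
      "z = ((complex_of_real (norm y) * u) *\<^sub>C x, complex_of_real (norm x) *\<^sub>C y)"
    have normz: "(norm z)\<^sup>2 = 2 * N\<^sup>2"
      by (simp add: z_def norm_Pair norm_scaleC norm_mult u N_def power_mult_distrib)
    have "cinner (A z) z = complex_of_real N * (cnj u * a + u * cnj b)"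
      by (simp add: z_def form sc1 sc2 cinner_scaleC_left cinner_scaleC_right a_def b_def N_def
          algebra_simps)
    then have "cmod (cinner (A z) z) = N * (cmod a + cmod b)"
      using N by (simp add: norm_mult align)
    then have "N * (cmod a + cmod b) \<le> w * (2 * N\<^sup>2)"
      using radius(1)[of z] by (simp add: w_def A_def normz)
    also have "\<dots> = N * (2 * w * N)"
      by (simp add: power2_eq_square)
    finally have "cmod a + cmod b \<le> 2 * w * N"
      using N by simp
    then show ?thesis
      by (simp add: a_def b_def N_def mult.assoc)
  qed
qed

section \<open>The Euclidean operator norm\<close>

text \<open>Testing the form against \<open>x = f y\<close> gives \<open>(norm (f y))\<^sup>2 \<le> B * norm (f y) * norm y\<close>.\<close>

lemma onorm_le_of_cinner_le:
  fixes f :: "'a::complex_inner \<Rightarrow> 'b::complex_inner"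
  assumes "0 \<le> B" and form: "\<And>x y. cmod (cinner (f y) x) \<le> B * norm x * norm y"
  shows "onorm f \<le> B"
proof (rule onorm_bound[OF \<open>0 \<le> B\<close>])
  fix y
  have "norm (f y) * norm (f y) \<le> norm (f y) * (B * norm y)"
    using form[where x = "f y" and y = y]
    by (simp add: cinner_self norm_power power2_eq_square norm_mult mult_ac)
  then show "norm (f y) \<le> B * norm y"
    using \<open>0 \<le> B\<close> by (cases "f y = 0") auto
qed

theorem theorem2p2:
  fixes T\<^sub>1 T\<^sub>2 :: "'a::complex_hilbert \<Rightarrow> 'a"
  assumes "bounded_clinear T\<^sub>1" and "bounded_clinear T\<^sub>2"
  shows "1 / 2 * euclidean_onorm T\<^sub>1 T\<^sub>2
    \<le> numerical_radius (op_matrix (\<lambda>_. 0) T\<^sub>1 (cadjoint T\<^sub>2) (\<lambda>_. 0))"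
proof -
  define w where "w = numerical_radius (op_matrix (\<lambda>_. 0) T\<^sub>1 (cadjoint T\<^sub>2) (\<lambda>_. 0))"
  have forms: "cmod (cinner (T\<^sub>1 y) x) + cmod (cinner (T\<^sub>2 y) x) \<le> 2 * w * norm x * norm y" for x y
    unfolding w_def by (rule offdiagonal_forms_le(1)[OF assms])
  have w: "0 \<le> w"
    unfolding w_def by (rule offdiagonal_forms_le(2)[OF assms])
  have "onorm (\<lambda>x. l\<^sub>1 *\<^sub>C T\<^sub>1 x + l\<^sub>2 *\<^sub>C T\<^sub>2 x) \<le> 2 * w"
    if l: "(cmod l\<^sub>1)\<^sup>2 + (cmod l\<^sub>2)\<^sup>2 = 1" for l\<^sub>1 l\<^sub>2
  proof (rule onorm_le_of_cinner_le)
    show "0 \<le> 2 * w"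
      using w by simp
    fix x y
    have "(cmod l\<^sub>1)\<^sup>2 \<le> 1" "(cmod l\<^sub>2)\<^sup>2 \<le> 1"
      using l zero_le_power2[of "cmod l\<^sub>1"] zero_le_power2[of "cmod l\<^sub>2"] by linarith+
    then have le1: "cmod l\<^sub>1 \<le> 1" "cmod l\<^sub>2 \<le> 1"
      by (simp_all add: power_le_one_iff)
    have "cmod (cinner (l\<^sub>1 *\<^sub>C T\<^sub>1 y + l\<^sub>2 *\<^sub>C T\<^sub>2 y) x)
        \<le> cmod l\<^sub>1 * cmod (cinner (T\<^sub>1 y) x) + cmod l\<^sub>2 * cmod (cinner (T\<^sub>2 y) x)"
      by (simp add: cinner_add_left cinner_scaleC_left norm_mult[symmetric] norm_triangle_ineq)
    also have "\<dots> \<le> cmod (cinner (T\<^sub>1 y) x) + cmod (cinner (T\<^sub>2 y) x)"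
      using le1 by (intro add_mono mult_left_le_one_le) simp_all
    also have "\<dots> \<le> 2 * w * norm x * norm y"
      by (rule forms)
    finally show "cmod (cinner (l\<^sub>1 *\<^sub>C T\<^sub>1 y + l\<^sub>2 *\<^sub>C T\<^sub>2 y) x) \<le> 2 * w * norm x * norm y" .
  qed
  moreover have "\<exists>l\<^sub>1 l\<^sub>2 :: complex. (cmod l\<^sub>1)\<^sup>2 + (cmod l\<^sub>2)\<^sup>2 = 1"
    by (intro exI[of _ 1] exI[of _ 0]) simp
  ultimately have "euclidean_onorm T\<^sub>1 T\<^sub>2 \<le> 2 * w"
    unfolding euclidean_onorm_def by (intro cSup_least) blast+
  then show ?thesis
    by (simp add: w_def)
qed

end
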